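(* Let $\mathscr{C}$ be a finite fuzzy covering on $\mathbb{U}$, let $O$ be an overlap function and $I_O$ its $R_O$-implicator. Let $N_1^{\mathscr{C}}$, $N_1^{\mathscr{C}_1}$ and $N_1^{\mathscr{C}_\cap}$ be the fuzzy neighborhood operators defined by $I_O$ from the coverings $\mathscr{C}$, $\mathscr{C}_1$ and $\mathscr{C}_\cap$ respectively. Then (1) $N_1^{\mathscr{C}}=N_1^{\mathscr{C}_1}$; (2) $N_1^{\mathscr{C}}=N_1^{\mathscr{C}_\cap}$.
   Context: $\mathbb{U}$ is a non-empty set; fuzzy subsets of $\mathbb{U}$ are maps $\mathbb{U}\to[0,1]$; inclusion is pointwise $\le$ and intersection is the pointwise infimum. A fuzzy covering on $\mathbb{U}$ is a collection $\mathscr{C}$ of fuzzy subsets of $\mathbb{U}$, none identically $0$, such that for every $x\in\mathbb{U}$ there is $K\in\mathscr{C}$ with $K(x)=1$. For $x\in\mathbb{U}$: $\mathbb{C}(\mathscr{C},x)=\{K\in\mathscr{C}:K(x)>0\}$; $md(\mathscr{C},x)=\{K\in\mathbb{C}(\mathscr{C},x):\forall S\in\mathbb{C}(\mathscr{C},x),\ (S(x)=K(x)\text{ and }S\subseteq K)\Rightarrow S=K\}$. Derived coverings: $\mathscr{C}_1=\bigcup\{md(\mathscr{C},x):x\in\mathbb{U}\}$; $\mathscr{C}_\cap=\mathscr{C}\setminus\{K\in\mathscr{C}:\exists\text{ non-empty }\mathscr{C}'\subseteq\mathscr{C}\setminus\{K\}\text{ with }K=\bigcap\mathscr{C}'\}$.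 An overlap function is a map $O:[0,1]^2\to[0,1]$ that is commutative, increasing (non-decreasing in each argument), continuous, and satisfies $O(x,y)=0\iff xy=0$ and $O(x,y)=1\iff xy=1$. Its $R_O$-implicator is $I_O(x,y)=\max\{z\in[0,1]:O(x,z)\le y\}$. For a collection $\mathscr{D}$ of fuzzy sets and $x,y\in\mathbb{U}$: $N_1^{\mathscr{D}}(x)(y)=\inf_{K\in\mathscr{D}}I_O(K(x),K(y))$. Equality of operators means equality of $N(x)(y)$ for all $x,y\in\mathbb{U}$. *)

theory Defs
  imports "HOL-Analysis.Analysis"
begin

text \<open>The non-empty universe is the type \<open>'a\<close>. A fuzzy subset of it is a function into the reals
  with values in \<open>{0..1}\<close>; fuzzy inclusion is the library's pointwise order \<open>S \<le> K\<close> on functions.\<close>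

definition fuzzy_set :: "('a \<Rightarrow> real) \<Rightarrow> bool" where
  "fuzzy_set K \<longleftrightarrow> (\<forall>x. K x \<in> {0..1})"

text \<open>\<open>Inf {}\<close> is unspecified on the reals, so \<open>fuzzy_Inter\<close> and \<open>N1\<close> below are meaningful only for
  non-empty collections. \<open>fuzzy_Inter\<close> is only used for such; for \<open>N1\<close>, a finite covering and both
  coverings derived from it are non-empty.\<close>

definition fuzzy_Inter :: "('a \<Rightarrow> real) set \<Rightarrow> 'a \<Rightarrow> real" where
  "fuzzy_Inter D = (\<lambda>x. INF K\<in>D. K x)"

definition fuzzy_covering :: "('a \<Rightarrow> real) set \<Rightarrow> bool" where
  "fuzzy_covering C \<longleftrightarrow>
     (\<forall>K\<in>C. fuzzy_set K \<and> K \<noteq> (\<lambda>x. 0)) \<and> (\<forall>x. \<exists>K\<in>C. K x = 1)"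

definition cov_at :: "('a \<Rightarrow> real) set \<Rightarrow> 'a \<Rightarrow> ('a \<Rightarrow> real) set" where
  "cov_at C x = {K \<in> C. K x > 0}"

definition md :: "('a \<Rightarrow> real) set \<Rightarrow> 'a \<Rightarrow> ('a \<Rightarrow> real) set" where
  "md C x = {K \<in> cov_at C x. \<forall>S \<in> cov_at C x. S x = K x \<and> S \<le> K \<longrightarrow> S = K}"

definition cov_1 :: "('a \<Rightarrow> real) set \<Rightarrow> ('a \<Rightarrow> real) set" where
  "cov_1 C = (\<Union>x. md C x)"

definition cov_cap :: "('a \<Rightarrow> real) set \<Rightarrow> ('a \<Rightarrow> real) set" where
  "cov_cap C = C - {K \<in> C. \<exists>C'. C' \<noteq> {} \<and> C' \<subseteq> C - {K} \<and> K = fuzzy_Inter C'}"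

definition overlap_function :: "(real \<Rightarrow> real \<Rightarrow> real) \<Rightarrow> bool" where
  "overlap_function Ov \<longleftrightarrow>
     (\<forall>x\<in>{0..1}. \<forall>y\<in>{0..1}. Ov x y \<in> {0..1}) \<and>
     (\<forall>x\<in>{0..1}. \<forall>y\<in>{0..1}. Ov x y = Ov y x) \<and>
     (\<forall>x\<in>{0..1}. mono_on {0..1} (\<lambda>y. Ov x y)) \<and>
     (\<forall>y\<in>{0..1}. mono_on {0..1} (\<lambda>x. Ov x y)) \<and>
     continuous_on ({0..1} \<times> {0..1}) (\<lambda>(x, y). Ov x y) \<and>
     (\<forall>x\<in>{0..1}. \<forall>y\<in>{0..1}. Ov x y = 0 \<longleftrightarrow> x * y = 0) \<and>
     (\<forall>x\<in>{0..1}. \<forall>y\<in>{0..1}. Ov x y = 1 \<longleftrightarrow> x * y = 1)"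

text \<open>The maximum of an in general infinite set, hence \<open>GREATEST\<close> rather than the library's \<open>Max\<close>,
  which is meant for finite sets. It exists for \<open>x, y\<close> in \<open>{0..1}\<close>: \<open>z = 0\<close> is admissible, and
  the admissible \<open>z\<close> form a compact set by continuity of \<open>Ov\<close>.\<close>

definition R_implicator :: "(real \<Rightarrow> real \<Rightarrow> real) \<Rightarrow> real \<Rightarrow> real \<Rightarrow> real" where
  "R_implicator Ov x y = (GREATEST z. z \<in> {0..1} \<and> Ov x z \<le> y)"

definition N1 :: "(real \<Rightarrow> real \<Rightarrow> real) \<Rightarrow> ('a \<Rightarrow> real) set \<Rightarrow> 'a \<Rightarrow> 'a \<Rightarrow> real" where
  "N1 I D x y = (INF K\<in>D. I (K x) (K y))"

end

theory Submission
  imports Defs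
begin

text \<open>The operator \<open>N1\<close> is unchanged when passing to a subfamily \<open>D\<close> of \<open>C\<close> as soon as every
  \<open>I\<^sub>O(K(x), K(y))\<close> with \<open>K\<close> in \<open>C\<close> dominates some \<open>I\<^sub>O(K'(x), K'(y))\<close> with \<open>K'\<close> in \<open>D\<close>. The implicator
  is decreasing in its first and increasing in its second argument. For \<open>cov_1\<close>, take \<open>K'\<close> minimal
  below \<open>K\<close> with the same value at \<open>x\<close> (if \<open>K(x) = 0\<close>, the implicator is \<open>1\<close>). For \<open>cov_cap\<close>, a
  reducible \<open>K\<close> is a finite infimum, attained at \<open>y\<close> by some strictly larger \<open>K'\<close> in \<open>C\<close>; iterating
  this terminates because \<open>C\<close> is finite.\<close>

text \<open>These facts replace the \<open>GREATEST\<close> operator from here on; with monotonicity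
  of \<open>Ov\<close>, the last two amount to residuation.\<close>

lemma R_implicator_greatest:
  assumes O: "overlap_function Ov" and x: "x \<in> {0..1}" and y: "y \<in> {0..1}"
  shows "R_implicator Ov x y \<in> {0..1}"
    and "Ov x (R_implicator Ov x y) \<le> y"
    and "\<And>z. z \<in> {0..1} \<Longrightarrow> Ov x z \<le> y \<Longrightarrow> z \<le> R_implicator Ov x y"
proof -
  let ?A = "{z \<in> {0..1}. Ov x z \<le> y}"
  have "continuous_on ({0..1} \<times> {0..1}) (\<lambda>(x, y). Ov x y)"
    using O by (simp add: overlap_function_def)
  then have "continuous_on {0..1} ((\<lambda>(x, y). Ov x y) \<circ> Pair x)"
    by (intro continuous_on_compose continuous_intros) (use x in \<open>auto elim: continuous_on_subset\<close>)
  then have "continuous_on {0..1} (\<lambda>z. Ov x z)"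
    by (simp add: comp_def)
  then have "closed ?A"
    by (intro continuous_on_closed_Collect_le continuous_intros) auto
  moreover have "bounded ?A"
    by (rule bounded_subset[of "{0..1}"]) auto
  ultimately have "compact ?A"
    by (simp add: compact_eq_bounded_closed)
  moreover have "Ov x 0 = 0"
    using O x by (simp add: overlap_function_def)
  then have "0 \<in> ?A"
    using y by simp
  ultimately obtain s where s: "s \<in> ?A" "\<forall>t\<in>?A. t \<le> s"
    using compact_attains_sup[of ?A] by blast
  then have "R_implicator Ov x y = s"
    unfolding R_implicator_def by (intro Greatest_equality) auto
  then show "R_implicator Ov x y \<in> {0..1}" "Ov x (R_implicator Ov x y) \<le> y"
    "\<And>z. z \<in> {0..1} \<Longrightarrow> Ov x z \<le> y \<Longrightarrow> z \<le> R_implicator Ov x y"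
    using s by auto
qed

text \<open>The maximal \<open>z\<close> for \<open>(x, y)\<close> stays admissible for
  \<open>(x', y')\<close>.\<close>

lemma R_implicator_mono:
  assumes O: "overlap_function Ov"
    and "x \<in> {0..1}" "y \<in> {0..1}" "x' \<in> {0..1}" "y' \<in> {0..1}" "x' \<le> x" "y \<le> y'"
  shows "R_implicator Ov x y \<le> R_implicator Ov x' y'"
proof -
  let ?z = "R_implicator Ov x y"
  have z: "?z \<in> {0..1}" "Ov x ?z \<le> y"
    using R_implicator_greatest assms by blast+
  then have "mono_on {0..1} (\<lambda>x. Ov x ?z)"
    using O by (simp add: overlap_function_def)
  then have "Ov x' ?z \<le> Ov x ?z"
    by (rule mono_onD) (use assms in auto)
  then show ?thesis
    using R_implicator_greatest(3) assms z by force
qed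

lemma R_implicator_0:
  assumes O: "overlap_function Ov" and y: "y \<in> {0..1}"
  shows "R_implicator Ov 0 y = 1"
proof -
  have "Ov 0 1 = 0"
    using O by (simp add: overlap_function_def)
  then show ?thesis
    using R_implicator_greatest(1)[OF O _ y, of 0] R_implicator_greatest(3)[OF O _ y, of 0 1] y by auto
qed

lemma N1_subfamily_eq:
  assumes "D \<subseteq> C" "finite C" "C \<noteq> {}"
    and dom: "\<And>K x y. K \<in> C \<Longrightarrow> \<exists>K'\<in>D. I (K' x) (K' y) \<le> I (K x) (K y)"
  shows "N1 I C = N1 I D"
proof (intro ext antisym)
  fix x y
  \<comment> \<open>Real infima can be compared memberwise only over non-empty index sets with
    values bounded below.\<close>
  have "finite D" "D \<noteq> {}"
    using assms finite_subset by blast+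
  then show "N1 I C x y \<le> N1 I D x y" "N1 I D x y \<le> N1 I C x y"
    unfolding N1_def using assms by (intro cINF_mono bdd_below_finite finite_imageI; blast)+
qed

lemma fuzzy_covering_range:
  "fuzzy_covering C \<Longrightarrow> K \<in> C \<Longrightarrow> K x \<in> {0..1}"
  unfolding fuzzy_covering_def fuzzy_set_def by blast

lemma cov_1_below:
  assumes "finite C" "K \<in> C" "K x > 0"
  shows "\<exists>S\<in>cov_1 C. S x = K x \<and> S \<le> K"
proof -
  have "finite {S \<in> C. S x = K x \<and> S \<le> K}" "K \<in> {S \<in> C. S x = K x \<and> S \<le> K}"
    using assms by auto
  from finite_has_minimal2[OF this] obtain S
    where S: "S \<in> C" "S x = K x" "S \<le> K"
      and min: "\<And>T. T \<in> C \<Longrightarrow> T x = K x \<Longrightarrow> T \<le> K \<Longrightarrow> T \<le> S \<Longrightarrow> S = T"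
    by blast
  \<comment> \<open>A competitor \<open>T\<close> in the \<open>md\<close> condition for
    \<open>S\<close> also lies below \<open>K\<close> with the same value at \<open>x\<close>, so
    minimality of \<open>S\<close> applies to it.\<close>
  have "T = S" if "T \<in> cov_at C x" "T x = S x" "T \<le> S" for T
    using min[of T] S that order_trans[of T S K] by (auto simp: cov_at_def)
  then have "S \<in> md C x"
    using S assms by (auto simp: md_def cov_at_def)
  then show ?thesis
    using S by (auto simp: cov_1_def)
qed

lemma cov_cap_above:
  assumes "finite C" "K \<in> C"
  shows "\<exists>S\<in>cov_cap C. K \<le> S \<and> S y = K y"
proof (rule ccontr)
  \<comment> \<open>The iteration becomes a maximal counterexample \<open>M\<close> in the finite
    set \<open>?B\<close>.\<close>
  let ?B = "{K \<in> C. \<not> (\<exists>S\<in>cov_cap C. K \<le> S \<and> S y = K y)}"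
  assume "\<not> ?thesis"
  then have "finite ?B" "?B \<noteq> {}"
    using assms by auto
  from finite_has_maximal[OF this] obtain M
    where M: "M \<in> C" "\<not> (\<exists>S\<in>cov_cap C. M \<le> S \<and> S y = M y)"
      and max: "\<And>T. T \<in> ?B \<Longrightarrow> M \<le> T \<Longrightarrow> M = T"
    by blast
  from M have "M \<notin> cov_cap C"
    by blast
  with M obtain C' where C': "C' \<noteq> {}" "C' \<subseteq> C - {M}" "M = fuzzy_Inter C'"
    by (auto simp: cov_cap_def)
  have fin: "finite C'"
    using C' assms finite_subset by blast
  \<comment> \<open>A finite infimum is a minimum, so some member of \<open>C'\<close> attains it at
    \<open>y\<close>.\<close>
  have "M y \<in> (\<lambda>K. K y) ` C'"
    using C' fin Min_in[of "(\<lambda>K. K y) ` C'"] by (simp add: fuzzy_Inter_def cInf_eq_Min)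
  then obtain T where T: "T \<in> C'" "T y = M y"
    by force
  have "M \<le> T"
  proof (rule le_funI)
    fix x
    have "(INF K\<in>C'. K x) \<le> T x"
      using fin T by (intro cINF_lower bdd_below_finite finite_imageI)
    then show "M x \<le> T x"
      using C' by (simp add: fuzzy_Inter_def)
  qed
  moreover have "T \<in> C" "T \<noteq> M"
    using T C' by auto
  \<comment> \<open>\<open>T\<close> lies strictly above the maximal \<open>M\<close>, hence outside
    \<open>?B\<close>; its witness also serves \<open>M\<close>.\<close>
  ultimately obtain S where "S \<in> cov_cap C" "T \<le> S" "S y = T y"
    using max[of T] by blast
  with M T \<open>M \<le> T\<close> show False
    by (metis order_trans)
qed

theorem proposition4p1:
  fixes C :: "('a \<Rightarrow> real) set" and Ov :: "real \<Rightarrow> real \<Rightarrow> real"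
  assumes "fuzzy_covering C" and "finite C" and "overlap_function Ov"
  shows "N1 (R_implicator Ov) C = N1 (R_implicator Ov) (cov_1 C) \<and>
         N1 (R_implicator Ov) C = N1 (R_implicator Ov) (cov_cap C)"
proof
  let ?I = "R_implicator Ov"
  note range = fuzzy_covering_range[OF assms(1)]
  have "C \<noteq> {}"
    using assms(1) by (auto simp: fuzzy_covering_def)
  have sub: "cov_1 C \<subseteq> C" "cov_cap C \<subseteq> C"
    by (auto simp: cov_1_def md_def cov_at_def cov_cap_def)
  show "N1 ?I C = N1 ?I (cov_1 C)"
  proof (rule N1_subfamily_eq[OF sub(1) assms(2) \<open>C \<noteq> {}\<close>])
    fix K x y assume K: "K \<in> C"
    show "\<exists>K'\<in>cov_1 C. ?I (K' x) (K' y) \<le> ?I (K x) (K y)"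
    proof (cases "K x = 0")
      case True
      \<comment> \<open>The bound to beat is 1, so any member of \<open>cov_1 C\<close> will do;
        \<open>L\<close> only ensures that one exists.\<close>
      obtain L where "L \<in> C" "L x = 1"
        using assms(1) by (auto simp: fuzzy_covering_def)
      then obtain S where S: "S \<in> cov_1 C"
        using cov_1_below[OF assms(2), of L x] by auto
      then have "?I (S x) (S y) \<le> 1"
        using R_implicator_greatest(1)[OF assms(3) range range, of S S x y] sub by auto
      then show ?thesis
        using S True R_implicator_0[OF assms(3) range[OF K]] by auto
    next
      case False
      then have "K x > 0"
        using range[OF K, of x] by simp
      from cov_1_below[OF assms(2) K this]
      obtain S where S: "S \<in> cov_1 C" "S x = K x" "S \<le> K"
        by blast
      \<comment> \<open>First arguments agree; monotonicity in the second is used.\<close>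
      then have "?I (S x) (S y) \<le> ?I (K x) (K y)"
        using sub K by (intro R_implicator_mono[OF assms(3)] range) (auto simp: le_fun_def)
      then show ?thesis
        using S by blast
    qed
  qed
  show "N1 ?I C = N1 ?I (cov_cap C)"
  proof (rule N1_subfamily_eq[OF sub(2) assms(2) \<open>C \<noteq> {}\<close>])
    fix K x y assume K: "K \<in> C"
    from cov_cap_above[OF assms(2) K]
    obtain S where S: "S \<in> cov_cap C" "K \<le> S" "S y = K y"
      by blast
    \<comment> \<open>Dually, second arguments agree and the first one grows.\<close>
    then have "?I (S x) (S y) \<le> ?I (K x) (K y)"
      using sub K by (intro R_implicator_mono[OF assms(3)] range) (auto simp: le_fun_def)
    then show "\<exists>K'\<in>cov_cap C. ?I (K' x) (K' y) \<le> ?I (K x) (K y)"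
      using S by blast
  qed
qed

end
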